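(* Let $M=(M_{k,l})_{k,l\ge1}$ be the infinite matrix defined by $$M_{k,l}=\begin{cases}\displaystyle\binom{l}{k-l}&\text{if }k\ge l,\\0&\text{if }k<l.\end{cases}$$ Then $$\begin{pmatrix}P_0(X)\\P_1(X)\\P_2(X)\\\vdots\end{pmatrix}=e^{X\ln(M)}\begin{pmatrix}1\\0\\0\\\vdots\end{pmatrix}.$$
   Context: The matrix $M$ is lower triangular with ones on the diagonal, so $\ln(M)=\sum_{k\ge1}\frac{(-1)^{k-1}}{k}(M-I)^k$ is a well-defined strictly lower triangular infinite matrix (each entry is a finite sum), and $e^{X\ln(M)}=\sum_{i\ge0}\frac{X^i}{i!}\ln(M)^i$ is a well-defined matrix with entries in $\mathbb{K}[X]$, $\mathbb{K}$ a field of characteristic zero. The polynomials $P_n\in\mathbb{K}[X]$ are $P_n=\phi_{\mathcal{NCP}}(J_n)$ for $n\ge1$, where $J_n=\{\{1\},\ldots,\{n\}\}$ is the noncrossing partition of $\{1,\ldots,n\}$ into singletons and $\phi_{\mathcal{NCP}}$ is the fundamental polynomial invariant of noncrossing partitions, and $P_0=1$. Equivalently, $(P_n)_{n\ge0}$ is the unique sequence of polynomials such that $P_0(X)=1$ and, for all $k\ge1$, $P_k(0)=0$ and $P_k(X+1)=P_k(X)+\sum_{i=1}^kP_{i-1}(X)P_{k-i}(X)$. Also equivalently, for $n,N\ge1$, $P_n(N)$ is the number of maps $c:\{1,\ldots,n\}\to\{1,\ldots,N\}$ such that whenever $p<r$ and $c(p)=c(r)$ there is $q$ with $p<q<r$ and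 $c(q)<c(p)$. *)

theory Defs
  imports
    "HOL-Computational_Algebra.Polynomial"
    "HOL-Library.Groups_Big_Fun"
begin

section \<open>The polynomials \<open>P\<^sub>n\<close>\<close>

text \<open>
  The polynomials \<open>P\<^sub>n\<close> are the values of the fundamental polynomial invariant on the
  noncrossing partitions into singletons. They are introduced through the recursive
  description that determines the sequence; \<^term>\<open>pcompose p [:1, 1:]\<close> is \<open>p(X + 1)\<close>.
\<close>

definition is_singleton_poly_seq :: "(nat \<Rightarrow> 'a::field_char_0 poly) \<Rightarrow> bool" where
  "is_singleton_poly_seq P \<longleftrightarrow>
     P 0 = 1 \<and>
     (\<forall>k\<ge>1. poly (P k) 0 = 0 \<and>
        pcompose (P k) [:1, 1:] = P k + (\<Sum>i=1..k. P (i - 1) * P (k - i)))"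

definition singleton_poly :: "nat \<Rightarrow> 'a::field_char_0 poly" where
  "singleton_poly = (THE P. is_singleton_poly_seq P)"

text \<open>Existence and uniqueness, which make the definite description meaningful.\<close>

lemma poly_eq_if_same_difference:
  fixes p q :: "'a::field_char_0 poly"
  assumes "poly p 0 = poly q 0"
    and "pcompose p [:1, 1:] - p = pcompose q [:1, 1:] - q"
  shows "p = q"
proof -
  define d where "d = p - q"
  have *: "pcompose d [:1, 1:] = d"
    using assms(2) by (simp add: d_def pcompose_diff algebra_simps)
  have step: "poly d (1 + x) = poly d x" for x
    using arg_cong[OF *, of "\<lambda>p. poly p x"] by (simp add: poly_pcompose)
  have "poly d (of_nat n) = 0" for n
  proof (induction n)
    case 0
    then show ?case
      using assms(1) by (simp add: d_def)
  next
    case (Suc n)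
    then show ?case
      by (simp add: step)
  qed
  then have "range (of_nat :: nat \<Rightarrow> 'a) \<subseteq> {x. poly d x = 0}"
    by auto
  moreover have "infinite (range (of_nat :: nat \<Rightarrow> 'a))"
    by (simp add: finite_image_iff inj_of_nat)
  ultimately have "d = 0"
    using poly_roots_finite finite_subset by blast
  then show ?thesis
    by (simp add: d_def)
qed

lemma ex_poly_with_difference:
  fixes q :: "'a::field_char_0 poly"
  shows "\<exists>p. poly p 0 = 0 \<and> pcompose p [:1, 1:] - p = q"
proof -
  have "\<forall>i\<ge>n. coeff q i = 0 \<Longrightarrow> \<exists>p. poly p 0 = 0 \<and> pcompose p [:1, 1:] - p = q" for n
  proof (induction n arbitrary: q)
    case 0
    then have "q = 0"
      by (simp add: poly_eq_iff)
    then show ?case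
      by (intro exI[of _ 0]) simp
  next
    case (Suc n)
    define m :: "'a poly" where "m = monom 1 (Suc n)"
    define D where "D = pcompose m [:1, 1:] - m"
    have D: "D = [:1, 1:] ^ Suc n - monom 1 (Suc n)"
      by (simp add: D_def m_def pcompose_altdef poly_monom map_poly_monom del: power_Suc)
    have "coeff ([:1, 1::'a:] ^ Suc n) i = of_nat (Suc n choose i)" for i
    proof (cases "i \<le> Suc n")
      case True
      then show ?thesis
        by (simp only: coeff_linear_poly_power) simp
    next
      case False
      then show ?thesis
        using degree_power_le[of "[:1, 1::'a:]" "Suc n"] by (simp add: coeff_eq_0 del: power_Suc)
    qed
    then have coeff_D: "coeff D i = (if i = Suc n then 0 else of_nat (Suc n choose i))" for i
      by (simp add: D coeff_diff del: power_Suc)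
    define c where "c = coeff q n / of_nat (Suc n)"
    have "coeff (q - smult c D) i = 0" if i: "i \<ge> n" for i
    proof -
      consider "i = n" | "i = Suc n" | "i > Suc n"
        using i by linarith
      then show ?thesis
        using Suc.prems
        by cases (simp_all add: coeff_D c_def del: of_nat_Suc)
    qed
    with Suc.IH obtain p where p: "poly p 0 = 0" "pcompose p [:1, 1:] - p = q - smult c D"
      by blast
    have "poly (p + smult c m) 0 = 0"
      by (simp add: p m_def poly_monom)
    moreover have "pcompose (p + smult c m) [:1, 1:] - (p + smult c m) =
        (pcompose p [:1, 1:] - p) + smult c D"
      by (simp add: D_def pcompose_add pcompose_smult smult_diff_right)
    ultimately show ?case
      using p(2) by (intro exI[of _ "p + smult c m"]) simp
  qed
  from this[of "Suc (degree q)"] show ?thesis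
    by (simp add: coeff_eq_0)
qed

lemma ex1_singleton_poly_seq:
  "\<exists>!P :: nat \<Rightarrow> 'a::field_char_0 poly. is_singleton_poly_seq P"
proof (rule ex_ex1I)
  let ?Q = "\<lambda>(P :: nat \<Rightarrow> 'a poly) k p. if k = 0 then p = 1 else
      poly p 0 = 0 \<and> pcompose p [:1, 1:] - p = (\<Sum>i=1..k. P (i - 1) * P (k - i))"
  have "\<exists>P. \<forall>k. ?Q P k (P k)"
  proof (rule dependent_wellorder_choice)
    fix r and f g :: "nat \<Rightarrow> 'a poly" and k
    assume "\<And>y. y < k \<Longrightarrow> f y = g y"
    then have "(\<Sum>i=1..k. f (i - 1) * f (k - i)) = (\<Sum>i=1..k. g (i - 1) * g (k - i))"
      by (intro sum.cong) auto
    then show "?Q f k r = ?Q g k r"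
      by simp
  next
    fix k and f :: "nat \<Rightarrow> 'a poly"
    show "\<exists>r. ?Q f k r"
      using ex_poly_with_difference by (cases "k = 0") auto
  qed
  then obtain P :: "nat \<Rightarrow> 'a poly" where P: "\<And>k. ?Q P k (P k)"
    by blast
  have "P 0 = 1"
    using P[of 0] by simp
  moreover have "poly (P k) 0 = 0 \<and>
      pcompose (P k) [:1, 1:] = P k + (\<Sum>i=1..k. P (i - 1) * P (k - i))" if "k \<ge> 1" for k
    using P[of k] that by (auto simp: algebra_simps)
  ultimately show "\<exists>P :: nat \<Rightarrow> 'a poly. is_singleton_poly_seq P"
    unfolding is_singleton_poly_seq_def by blast
next
  fix P P' :: "nat \<Rightarrow> 'a poly"
  assume P: "is_singleton_poly_seq P" and P': "is_singleton_poly_seq P'"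
  have "P k = P' k" for k
  proof (induction k rule: less_induct)
    case (less k)
    show ?case
    proof (cases "k = 0")
      case True
      then show ?thesis
        using P P' by (simp add: is_singleton_poly_seq_def)
    next
      case False
      have IH: "P j = P' j" if "j < k" for j
        using less that .
      have sum_eq: "(\<Sum>i=1..k. P (i - 1) * P (k - i)) = (\<Sum>i=1..k. P' (i - 1) * P' (k - i))"
        by (intro sum.cong refl arg_cong2[of _ _ _ _ "(*)"] IH) auto
      have diff: "pcompose (R k) [:1, 1:] - R k = (\<Sum>i=1..k. R (i - 1) * R (k - i))"
        and zero: "poly (R k) 0 = 0"
        if "is_singleton_poly_seq R" for R :: "nat \<Rightarrow> 'a poly"
      proof -
        have "poly (R k) 0 = 0 \<and>
            pcompose (R k) [:1, 1:] = R k + (\<Sum>i=1..k. R (i - 1) * R (k - i))"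
          using that False unfolding is_singleton_poly_seq_def by (meson less_one not_le)
        then show "pcompose (R k) [:1, 1:] - R k = (\<Sum>i=1..k. R (i - 1) * R (k - i))"
          and "poly (R k) 0 = 0"
          by (simp_all only: add_diff_cancel_left')
      qed
      show ?thesis
      proof (rule poly_eq_if_same_difference)
        show "poly (P k) 0 = poly (P' k) 0"
          by (simp only: zero[OF P] zero[OF P'])
        show "pcompose (P k) [:1, 1:] - P k = pcompose (P' k) [:1, 1:] - P' k"
          by (simp only: diff[OF P] diff[OF P'] sum_eq)
      qed
    qed
  qed
  then show "P = P'"
    by blast
qed

lemma is_singleton_poly_seq_singleton_poly: "is_singleton_poly_seq singleton_poly"
  unfolding singleton_poly_def by (rule theI'[OF ex1_singleton_poly_seq])


section \<open>Infinite matrices\<close>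

text \<open>
  A matrix with rows and columns numbered \<open>1, 2, \<dots>\<close> is represented by a function on
  \<^typ>\<open>nat\<close> whose value at \<open>(k, l)\<close> is the entry in row \<open>k + 1\<close> and column \<open>l + 1\<close>;
  similarly for vectors. All infinite sums are entrywise sums with finitely many nonzero
  terms; \<^const>\<open>Sum_any\<close> has the value \<open>0\<close> on other families.
\<close>

type_synonym 'a inf_matrix = "nat \<Rightarrow> nat \<Rightarrow> 'a"

definition inf_mat_one :: "'a::semiring_1 inf_matrix" where
  "inf_mat_one k l = (if k = l then 1 else 0)"

definition inf_mat_diff :: "'a::ring inf_matrix \<Rightarrow> 'a inf_matrix \<Rightarrow> 'a inf_matrix" where
  "inf_mat_diff A B k l = A k l - B k l"

definition inf_mat_mult :: "'a::semiring_0 inf_matrix \<Rightarrow> 'a inf_matrix \<Rightarrow> 'a inf_matrix" where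
  "inf_mat_mult A B k l = Sum_any (\<lambda>j. A k j * B j l)"

definition inf_mat_vec :: "'a::semiring_0 inf_matrix \<Rightarrow> (nat \<Rightarrow> 'a) \<Rightarrow> nat \<Rightarrow> 'a" where
  "inf_mat_vec A v k = Sum_any (\<lambda>l. A k l * v l)"

primrec inf_mat_power :: "'a::semiring_1 inf_matrix \<Rightarrow> nat \<Rightarrow> 'a inf_matrix" where
  "inf_mat_power A 0 = inf_mat_one"
| "inf_mat_power A (Suc n) = inf_mat_mult A (inf_mat_power A n)"

text \<open>The summand with index \<open>n\<close> below is the one with exponent \<open>n + 1\<close> in the usual series.\<close>

definition inf_mat_ln :: "'a::field_char_0 inf_matrix \<Rightarrow> 'a inf_matrix" where
  "inf_mat_ln A k l =
     Sum_any (\<lambda>n. (-1) ^ n / of_nat (Suc n) * inf_mat_power (inf_mat_diff A inf_mat_one) (Suc n) k l)"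

text \<open>The matrix \<open>e\<^bsup>XA\<^esup>\<close>, with polynomial entries.\<close>

definition inf_mat_exp_X :: "'a::field_char_0 inf_matrix \<Rightarrow> 'a poly inf_matrix" where
  "inf_mat_exp_X A k l = Sum_any (\<lambda>i. monom (inf_mat_power A i k l / fact i) i)"

definition binom_entry :: "nat \<Rightarrow> nat \<Rightarrow> 'a::semiring_1" where
  "binom_entry k l = (if k \<ge> l then of_nat (l choose (k - l)) else 0)"

definition binom_matrix :: "'a::semiring_1 inf_matrix" where
  "binom_matrix k l = binom_entry (Suc k) (Suc l)"

definition first_unit_vec :: "nat \<Rightarrow> 'a::semiring_1" where
  "first_unit_vec l = (if l = 0 then 1 else 0)"

text \<open>The families summed in the theorem do have finite support.\<close>

lemma finite_support_mult_row:
  fixes A :: "'a::semiring_0 inf_matrix"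
  assumes "\<And>k l. k < l \<Longrightarrow> A k l = 0"
  shows "finite {j. A k j * b j \<noteq> 0}"
proof (rule finite_subset)
  show "{j. A k j * b j \<noteq> 0} \<subseteq> {..k}"
  proof
    fix j
    assume "j \<in> {j. A k j * b j \<noteq> 0}"
    then have "A k j \<noteq> 0"
      by auto
    with assms[of k j] show "j \<in> {..k}"
      by (meson atMost_iff not_le)
  qed
qed simp

lemma inf_mat_power_strict_lower:
  assumes "\<And>k l. k \<le> l \<Longrightarrow> A k l = (0::'a::semiring_1)" and "k < l + n"
  shows "inf_mat_power A n k l = 0"
  using assms(2)
proof (induction n arbitrary: k)
  case 0
  then show ?case
    by (simp add: inf_mat_one_def)
next
  case (Suc n)
  have "A k j * inf_mat_power A n j l = 0" for j
    using Suc assms(1) by (cases "k \<le> j") auto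
  then show ?case
    by (simp add: inf_mat_mult_def)
qed

lemma binom_matrix_minus_one_strict_lower:
  "k \<le> l \<Longrightarrow> inf_mat_diff binom_matrix inf_mat_one k l = (0::'a::ring_1)"
  by (simp add: inf_mat_diff_def binom_matrix_def binom_entry_def inf_mat_one_def)

lemma finite_support_ln:
  assumes "\<And>k l. k \<le> l \<Longrightarrow> inf_mat_diff A inf_mat_one k l = (0::'a::field_char_0)"
  shows "finite {n. (-1) ^ n / of_nat (Suc n) *
    inf_mat_power (inf_mat_diff A inf_mat_one) (Suc n) k l \<noteq> 0}" (is "finite ?S")
proof (rule finite_subset)
  show "?S \<subseteq> {..k}"
  proof
    fix n
    assume "n \<in> ?S"
    then have "inf_mat_power (inf_mat_diff A inf_mat_one) (Suc n) k l \<noteq> 0"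
      by (simp del: inf_mat_power.simps of_nat_Suc)
    moreover have "inf_mat_power (inf_mat_diff A inf_mat_one) (Suc n) k l = 0" if "k < n"
      using that by (intro inf_mat_power_strict_lower assms) auto
    ultimately show "n \<in> {..k}"
      by (meson atMost_iff not_le)
  qed
qed simp

lemma inf_mat_ln_strict_lower:
  assumes "\<And>k l. k \<le> l \<Longrightarrow> inf_mat_diff A inf_mat_one k l = (0::'a::field_char_0)"
    and "k \<le> l"
  shows "inf_mat_ln A k l = 0"
proof -
  have "inf_mat_power (inf_mat_diff A inf_mat_one) (Suc n) k l = 0" for n
    using assms(2) by (intro inf_mat_power_strict_lower assms(1)) auto
  then show ?thesis
    by (simp only: inf_mat_ln_def mult_zero_right Sum_any.neutral)
qed

lemma finite_support_exp_X:
  assumes "\<And>k l. k \<le> l \<Longrightarrow> A k l = (0::'a::field_char_0)"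
  shows "finite {i. monom (inf_mat_power A i k l / fact i) i \<noteq> 0}" (is "finite ?S")
proof (rule finite_subset)
  show "?S \<subseteq> {..k}"
  proof
    fix i
    assume "i \<in> ?S"
    then have "inf_mat_power A i k l \<noteq> 0"
      by auto
    moreover have "inf_mat_power A i k l = 0" if "k < i"
      using that by (intro inf_mat_power_strict_lower assms) auto
    ultimately show "i \<in> {..k}"
      by (meson atMost_iff not_le)
  qed
qed simp

lemma inf_mat_exp_X_lower:
  assumes "\<And>k l. k \<le> l \<Longrightarrow> A k l = (0::'a::field_char_0)" and "k < l"
  shows "inf_mat_exp_X A k l = 0"
proof -
  have "inf_mat_power A i k l = 0" for i
    using assms(2) by (intro inf_mat_power_strict_lower assms(1)) auto
  then show ?thesis
    by (simp only: inf_mat_exp_X_def div_0 monom_eq_0 Sum_any.neutral)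
qed

end

theory Submission
  imports
    Defs
    "HOL-Computational_Algebra.Formal_Power_Series"
begin

text \<open>
  Put \<open>f(h) = h + h\<^sup>2\<close>. The entry of \<open>M\<close> in row \<open>k\<close> and column \<open>l\<close> is the coefficient of
  \<open>h\<^sup>k\<close> in \<open>f\<^sup>l\<close>, so that \<open>M\<close> is the matrix of the substitution \<open>g \<mapsto> g \<circ> f\<close> acting on the
  coefficients of power series without constant term. Hence the first column of \<open>M\<^sup>N\<close>
  contains the coefficients of the \<open>N\<close>-fold iterate of \<open>f\<close>.

  On the other side, write \<open>F\<^sub>X(h)\<close> for the sum of all \<open>P\<^sub>n(X) h\<^bsup>n+1\<^esup>\<close>. The recursion for the
  \<open>P\<^sub>n\<close> says \<open>F\<^sub>0 = h\<close> and \<open>F\<^bsub>X+1\<^esub> = F\<^sub>X + F\<^sub>X\<^sup>2 = f \<circ> F\<^sub>X\<close>, so \<open>F\<^sub>N\<close> is the \<open>N\<close>-fold iterate of \<open>f\<close>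
  as well. Iterates of \<open>f\<close> commute with \<open>f\<close>, which reconciles the two orders of composition
  (\<open>fps_iterate_commute\<close>). Therefore \<open>P\<^sub>n(N)\<close> is the entry of \<open>M\<^sup>N\<close> in row \<open>n + 1\<close> and column \<open>1\<close>.

  It remains to see that \<open>e\<^bsup>X ln M\<^esup>\<close> takes the value \<open>M\<^sup>N\<close> at \<open>X = N\<close>
  (\<open>poly_inf_mat_exp_X_ln\<close>); then both sides of the theorem are polynomials that agree at all
  natural numbers. A strictly lower triangular matrix \<open>A\<close> can be substituted into power
  series, and this substitution is multiplicative (\<open>fps_eval_mult\<close>). With \<open>A = M - I\<close> the
  claim is then the image of the power series identity \<open>exp(N ln(1 + t)) = (1 + t)\<^sup>N\<close>.
\<close>

section \<open>Substituting a strictly lower triangular matrix into a power series\<close>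

definition strictly_lower :: "'a::zero inf_matrix \<Rightarrow> bool" where
  "strictly_lower A \<longleftrightarrow> (\<forall>k l. k \<le> l \<longrightarrow> A k l = 0)"

lemma strictly_lower_power_eq_0:
  fixes A :: "'a::semiring_1 inf_matrix"
  assumes "strictly_lower A" and "k < l + n"
  shows "inf_mat_power A n k l = 0"
  using assms by (intro inf_mat_power_strict_lower) (auto simp: strictly_lower_def)

lemma inf_mat_mult_lower:
  fixes A :: "'a::semiring_0 inf_matrix"
  assumes "\<And>k l. k < l \<Longrightarrow> A k l = 0"
  shows "inf_mat_mult A B k l = (\<Sum>j\<le>k. A k j * B j l)"
  unfolding inf_mat_mult_def
proof (rule Sum_any.expand_superset)
  show "{j. A k j * B j l \<noteq> 0} \<subseteq> {..k}"
    using assms by (force simp: not_le[symmetric])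
qed simp

lemma inf_mat_power_add:
  fixes A :: "'a::semiring_1 inf_matrix"
  assumes A: "strictly_lower A"
  shows "inf_mat_power A (m + n) k l = (\<Sum>i\<le>k. inf_mat_power A m k i * inf_mat_power A n i l)"
proof (induction m arbitrary: k)
  case 0
  show ?case
    by (simp add: inf_mat_one_def if_distrib[where f = "\<lambda>x. x * _"] cong: if_cong)
next
  case (Suc m)
  have mult: "inf_mat_mult A B k l = (\<Sum>j\<le>k. A k j * B j l)" for B l
    using A by (intro inf_mat_mult_lower) (auto simp: strictly_lower_def)
  have "inf_mat_power A (Suc m + n) k l = (\<Sum>j\<le>k. A k j * inf_mat_power A (m + n) j l)"
    by (simp add: mult)
  also have "\<dots> = (\<Sum>j\<le>k. A k j * (\<Sum>i\<le>k. inf_mat_power A m j i * inf_mat_power A n i l))"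
    unfolding Suc.IH
    by (intro sum.cong refl arg_cong2[where f = "(*)"] sum.mono_neutral_left)
       (auto simp: strictly_lower_power_eq_0[OF A])
  also have "\<dots> = (\<Sum>i\<le>k. (\<Sum>j\<le>k. A k j * inf_mat_power A m j i) * inf_mat_power A n i l)"
    by (simp add: sum_distrib_left sum_distrib_right mult.assoc) (rule sum.swap)
  also have "\<dots> = (\<Sum>i\<le>k. inf_mat_power A (Suc m) k i * inf_mat_power A n i l)"
    by (simp add: mult)
  finally show ?case .
qed

text \<open>
  The matrix \<open>g(A)\<close> for a power series \<open>g\<close>. Cutting the series off at the row index \<open>k\<close>
  (which starts from \<open>0\<close>) makes all sums finite and loses nothing if \<open>A\<close> is strictly lower
  triangular, since row \<open>k\<close> of \<open>A\<^sup>n\<close> is then zero for \<open>n > k\<close>.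
\<close>

definition fps_eval :: "'a::semiring_1 inf_matrix \<Rightarrow> 'a fps \<Rightarrow> 'a inf_matrix" where
  "fps_eval A g k l = (\<Sum>n\<le>k. fps_nth g n * inf_mat_power A n k l)"

lemma fps_eval_upto:
  fixes A :: "'a::semiring_1 inf_matrix"
  assumes "strictly_lower A" and "k \<le> K"
  shows "fps_eval A g k l = (\<Sum>n\<le>K. fps_nth g n * inf_mat_power A n k l)"
  unfolding fps_eval_def using assms
  by (intro sum.mono_neutral_left) (auto simp: strictly_lower_power_eq_0)

lemma fps_eval_lower:
  fixes A :: "'a::semiring_1 inf_matrix"
  assumes "strictly_lower A" and "k < l"
  shows "fps_eval A g k l = 0"
  unfolding fps_eval_def using assms
  by (intro sum.neutral) (auto simp: strictly_lower_power_eq_0)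

text \<open>
  The Cauchy product sums over \<open>m + n \<le> k\<close> only, while the matrix product also contains the
  pairs with \<open>m, n \<le> k\<close> and \<open>m + n > k\<close>; these contribute nothing because row \<open>k\<close> of
  \<open>A\<^bsup>m+n\<^esup>\<close> is then zero.
\<close>

lemma fps_eval_mult:
  fixes A :: "'a::comm_semiring_1 inf_matrix"
  assumes A: "strictly_lower A"
  shows "inf_mat_mult (fps_eval A g) (fps_eval A h) = fps_eval A (g * h)"
proof (intro ext)
  fix k l
  let ?t = "\<lambda>m n. fps_nth g m * fps_nth h n * inf_mat_power A (m + n) k l"
  have zero: "?t m n = 0" if "\<not> m + n \<le> k" for m n
    using that by (simp add: strictly_lower_power_eq_0[OF A])
  have "inf_mat_mult (fps_eval A g) (fps_eval A h) k l = (\<Sum>j\<le>k. fps_eval A g k j * fps_eval A h j l)"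
    by (intro inf_mat_mult_lower fps_eval_lower A)
  also have "\<dots> = (\<Sum>j\<le>k. (\<Sum>m\<le>k. fps_nth g m * inf_mat_power A m k j) *
      (\<Sum>n\<le>k. fps_nth h n * inf_mat_power A n j l))"
    by (intro sum.cong refl arg_cong2[where f = "(*)"] fps_eval_upto A) auto
  also have "\<dots> = (\<Sum>j\<le>k. \<Sum>m\<le>k. \<Sum>n\<le>k. fps_nth g m * fps_nth h n *
      (inf_mat_power A m k j * inf_mat_power A n j l))"
    by (simp add: sum_product mult_ac)
  also have "\<dots> = (\<Sum>m\<le>k. \<Sum>j\<le>k. \<Sum>n\<le>k. fps_nth g m * fps_nth h n *
      (inf_mat_power A m k j * inf_mat_power A n j l))"
    by (rule sum.swap)
  also have "\<dots> = (\<Sum>m\<le>k. \<Sum>n\<le>k. \<Sum>j\<le>k. fps_nth g m * fps_nth h n *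
      (inf_mat_power A m k j * inf_mat_power A n j l))"
    by (rule sum.cong[OF refl]) (rule sum.swap)
  also have "\<dots> = (\<Sum>m\<le>k. \<Sum>n\<le>k. ?t m n)"
    by (simp add: inf_mat_power_add[OF A] sum_distrib_left)
  also have "\<dots> = (\<Sum>(m, n)\<in>{..k} \<times> {..k}. ?t m n)"
    by (simp add: sum.cartesian_product)
  also have "\<dots> = (\<Sum>(m, n)\<in>{(m, n). m + n \<le> k}. ?t m n)"
    using zero by (intro sum.mono_neutral_right) auto
  also have "\<dots> = (\<Sum>s\<le>k. \<Sum>m\<le>s. ?t m (s - m))"
    by (rule sum.triangle_reindex_eq)
  also have "\<dots> = fps_eval A (g * h) k l"
    by (simp add: fps_eval_def fps_mult_nth sum_distrib_right atLeast0AtMost)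
  finally show "inf_mat_mult (fps_eval A g) (fps_eval A h) k l = fps_eval A (g * h) k l" .
qed

lemma fps_eval_1: "fps_eval A 1 = inf_mat_one"
  by (intro ext) (simp add: fps_eval_def if_distrib[where f = "\<lambda>x. x * _"] cong: if_cong)

lemma inf_mat_power_fps_eval:
  fixes A :: "'a::comm_semiring_1 inf_matrix"
  assumes "strictly_lower A"
  shows "inf_mat_power (fps_eval A g) n = fps_eval A (g ^ n)"
  by (induction n) (simp_all add: fps_eval_1 fps_eval_mult[OF assms])

text \<open>
  Evaluating up to row index \<open>k + 1\<close> instead of \<open>k\<close> keeps the linear term in the sum also in
  the row with index \<open>0\<close>.
\<close>

lemma fps_eval_1_plus_X:
  fixes B :: "'a::comm_ring_1 inf_matrix"
  assumes A: "strictly_lower (inf_mat_diff B inf_mat_one)"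
  shows "fps_eval (inf_mat_diff B inf_mat_one) (1 + fps_X) = B"
proof (intro ext)
  fix k l
  let ?A = "inf_mat_diff B inf_mat_one"
  have "inf_mat_mult ?A inf_mat_one k l = (\<Sum>j\<le>k. ?A k j * inf_mat_one j l)"
    using A by (intro inf_mat_mult_lower) (auto simp: strictly_lower_def)
  also have "\<dots> = ?A k l"
    using A by (auto simp: inf_mat_one_def strictly_lower_def if_distrib[where f = "\<lambda>x. _ * x"]
        cong: if_cong)
  finally have "inf_mat_mult ?A inf_mat_one k l = ?A k l" .
  moreover have "fps_eval ?A (1 + fps_X) k l =
      (\<Sum>n\<in>{0, 1}. fps_nth (1 + fps_X) n * inf_mat_power ?A n k l)"
    unfolding fps_eval_upto[OF A le_SucI[OF order_refl]]
    by (intro sum.mono_neutral_right) auto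
  ultimately show "fps_eval ?A (1 + fps_X) k l = B k l"
    by (simp add: inf_mat_diff_def)
qed


section \<open>Matrix exponential and logarithm\<close>

lemma inf_mat_ln_eq_fps_eval:
  fixes B :: "'a::field_char_0 inf_matrix"
  assumes A: "strictly_lower (inf_mat_diff B inf_mat_one)"
  shows "inf_mat_ln B = fps_eval (inf_mat_diff B inf_mat_one) (fps_ln 1)"
proof (intro ext)
  fix k l
  let ?A = "inf_mat_diff B inf_mat_one"
  let ?t = "\<lambda>n. (-1) ^ n / of_nat (Suc n) * inf_mat_power ?A (Suc n) k l"
  have "inf_mat_ln B k l = (\<Sum>n\<le>k. ?t n)"
    unfolding inf_mat_ln_def
  proof (rule Sum_any.expand_superset)
    show "{n. ?t n \<noteq> 0} \<subseteq> {..k}"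
    proof (rule subsetI, rule ccontr)
      fix n
      assume "n \<in> {n. ?t n \<noteq> 0}" and "n \<notin> {..k}"
      moreover from this have "inf_mat_power ?A (Suc n) k l = 0"
        by (intro strictly_lower_power_eq_0[OF A]) simp
      ultimately show False
        by (simp only: mem_Collect_eq mult_zero_right not_True_eq_False simp_thms)
    qed
  qed simp
  also have "\<dots> = (\<Sum>n\<le>k. fps_nth (fps_ln 1) (Suc n) * inf_mat_power ?A (Suc n) k l)"
    by (simp add: fps_ln_nth del: inf_mat_power.simps of_nat_Suc)
  also have "\<dots> = (\<Sum>n\<le>Suc k. fps_nth (fps_ln 1) n * inf_mat_power ?A n k l)"
    by (simp add: sum.atMost_Suc_shift del: inf_mat_power.simps sum.atMost_Suc)
  also have "\<dots> = fps_eval ?A (fps_ln 1) k l"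
    by (rule fps_eval_upto[OF A, symmetric]) simp
  finally show "inf_mat_ln B k l = fps_eval ?A (fps_ln 1) k l" .
qed

text \<open>
  For \<open>N = 1\<close> this holds since \<open>ln(1 + t)\<close> is the compositional inverse of \<open>exp(t) - 1\<close>; the
  general case is its \<open>N\<close>-th power.
\<close>

lemma fps_exp_compose_ln:
  "fps_exp (of_nat N) oo fps_ln 1 = (1 + fps_X :: 'a::field_char_0 fps) ^ N"
proof -
  have "(fps_exp 1 - 1) oo fps_ln 1 = (fps_X :: 'a fps)"
    by (subst fps_ln_fps_exp_inv) (simp_all add: fps_inv_right)
  then have "fps_exp 1 oo fps_ln 1 = (1 + fps_X :: 'a fps)"
    by (simp add: fps_compose_sub_distrib algebra_simps)
  then have "(fps_exp 1 ^ N) oo fps_ln 1 = (1 + fps_X :: 'a fps) ^ N"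
    by (simp add: fps_compose_power[symmetric])
  then show ?thesis
    by (simp add: fps_exp_power_mult)
qed

lemma poly_inf_mat_exp_X:
  fixes A :: "'a::field_char_0 inf_matrix"
  assumes "strictly_lower A"
  shows "poly (inf_mat_exp_X A k l) x = (\<Sum>i\<le>k. x ^ i / fact i * inf_mat_power A i k l)"
proof -
  have "inf_mat_exp_X A k l = (\<Sum>i\<le>k. monom (inf_mat_power A i k l / fact i) i)"
    unfolding inf_mat_exp_X_def
  proof (rule Sum_any.expand_superset)
    show "{i. monom (inf_mat_power A i k l / fact i) i \<noteq> 0} \<subseteq> {..k}"
      using strictly_lower_power_eq_0[OF assms, of k l] by (force simp: not_le[symmetric])
  qed simp
  then show ?thesis
    by (simp add: poly_sum poly_monom mult_ac)
qed

text \<open>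
  If \<open>L\<close> has no constant term, then substituting \<open>A\<close> into \<open>exp(x L)\<close> gives the exponential
  series of the matrix \<open>L(A)\<close>.
\<close>

lemma poly_inf_mat_exp_X_fps_eval:
  fixes A :: "'a::field_char_0 inf_matrix"
  assumes A: "strictly_lower A" and L: "fps_nth L 0 = 0"
  shows "poly (inf_mat_exp_X (fps_eval A L) k l) x = fps_eval A (fps_exp x oo L) k l"
proof -
  have "strictly_lower (fps_eval A L)"
    unfolding strictly_lower_def fps_eval_def
  proof (intro allI impI sum.neutral ballI)
    fix k l n :: nat
    assume "k \<le> l"
    then show "fps_nth L n * inf_mat_power A n k l = 0"
      using L by (cases n) (auto simp: strictly_lower_power_eq_0[OF A] simp del: inf_mat_power.simps)
  qed
  then have "poly (inf_mat_exp_X (fps_eval A L) k l) x =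
      (\<Sum>i\<le>k. x ^ i / fact i * (\<Sum>n\<le>k. fps_nth (L ^ i) n * inf_mat_power A n k l))"
    by (simp add: poly_inf_mat_exp_X inf_mat_power_fps_eval[OF A] fps_eval_def)
  also have "\<dots> = (\<Sum>n\<le>k. (\<Sum>i\<le>k. x ^ i / fact i * fps_nth (L ^ i) n) * inf_mat_power A n k l)"
    by (simp add: sum_distrib_left sum_distrib_right mult.assoc) (rule sum.swap)
  also have "\<dots> = (\<Sum>n\<le>k. fps_nth (fps_exp x oo L) n * inf_mat_power A n k l)"
  proof (intro sum.cong refl arg_cong2[where f = "(*)"])
    fix n
    assume "n \<in> {..k}"
    then show "(\<Sum>i\<le>k. x ^ i / fact i * fps_nth (L ^ i) n) = fps_nth (fps_exp x oo L) n"
      unfolding fps_compose_nth fps_exp_nth of_nat_fact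
      by (intro sum.mono_neutral_right) (auto simp: startsby_zero_power_prefix[OF L])
  qed
  finally show ?thesis
    by (simp add: fps_eval_def)
qed

text \<open>
  With \<open>A = B - I\<close>, the matrix \<open>e\<^bsup>N ln B\<^esup>\<close> arises by substituting \<open>A\<close> into
  \<open>exp(N ln(1 + t)) = (1 + t)\<^sup>N\<close>, which also gives \<open>(I + A)\<^sup>N = B\<^sup>N\<close>.
\<close>

lemma poly_inf_mat_exp_X_ln:
  fixes B :: "'a::field_char_0 inf_matrix"
  assumes A: "strictly_lower (inf_mat_diff B inf_mat_one)"
  shows "poly (inf_mat_exp_X (inf_mat_ln B) k l) (of_nat N) = inf_mat_power B N k l"
proof -
  let ?A = "inf_mat_diff B inf_mat_one"
  have "poly (inf_mat_exp_X (inf_mat_ln B) k l) (of_nat N) =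
      fps_eval ?A ((1 + fps_X) ^ N) k l"
    by (simp add: inf_mat_ln_eq_fps_eval[OF A] poly_inf_mat_exp_X_fps_eval[OF A] fps_exp_compose_ln)
  also have "\<dots> = inf_mat_power B N k l"
    by (simp add: inf_mat_power_fps_eval[OF A, symmetric] fps_eval_1_plus_X[OF A])
  finally show ?thesis .
qed


section \<open>Iterating \<open>h + h\<^sup>2\<close>\<close>

primrec fps_iterate :: "nat \<Rightarrow> 'a::comm_ring_1 fps" where
  "fps_iterate 0 = fps_X"
| "fps_iterate (Suc N) = fps_iterate N + fps_iterate N ^ 2"

lemma fps_iterate_nth_0 [simp]: "fps_nth (fps_iterate N) 0 = 0"
  by (induction N) (simp_all add: power2_eq_square)

text \<open>
  The definition composes with \<open>h + h\<^sup>2\<close> on the outside, as in the recursion for the polynomials;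
  multiplication by the matrix composes with it on the inside.
\<close>

lemma fps_iterate_commute:
  "(fps_iterate (Suc N) :: 'a::idom fps) = fps_iterate N oo (fps_X + fps_X ^ 2)"
proof (induction N)
  case 0
  show ?case
    by (simp add: fps_compose_add_distrib)
next
  case (Suc N)
  have "(fps_iterate (Suc N) oo (fps_X + fps_X ^ 2) :: 'a fps) =
      (fps_iterate N oo (fps_X + fps_X ^ 2)) + (fps_iterate N oo (fps_X + fps_X ^ 2)) ^ 2"
    by (simp add: fps_compose_add_distrib fps_compose_power)
  also have "\<dots> = fps_iterate (Suc (Suc N))"
    by (simp only: Suc.IH[symmetric] fps_iterate.simps(2)[of "Suc N"])
  finally show ?case ..
qed

lemma binom_entry_eq_fps_nth:
  "(binom_entry k l :: 'a::field_char_0) = fps_nth ((fps_X + fps_X ^ 2) ^ l) k"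
proof -
  have "(fps_X + fps_X ^ 2 :: 'a fps) ^ l = fps_X ^ l * (1 + fps_X) ^ l"
    by (simp add: power_mult_distrib[symmetric] power2_eq_square algebra_simps)
  then show ?thesis
    by (simp add: fps_X_power_mult_nth binom_entry_def fps_binomial_of_nat[symmetric]
        binomial_gbinomial)
qed

text \<open>
  One more factor \<open>M\<close> on the left substitutes \<open>h + h\<^sup>2\<close> into the series given by the column.
  Row and column indices start from \<open>0\<close>, exponents of \<open>h\<close> from \<open>1\<close>, hence the shift.
\<close>

lemma binom_matrix_power_first_column:
  "(inf_mat_power binom_matrix N k 0 :: 'a::field_char_0) = fps_nth (fps_iterate N) (Suc k)"
proof (induction N arbitrary: k)
  case 0
  show ?case
    by (simp add: inf_mat_one_def)
next
  case (Suc N)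
  have "(inf_mat_power binom_matrix (Suc N) k 0 :: 'a) =
      (\<Sum>j\<le>k. binom_matrix k j * fps_nth (fps_iterate N) (Suc j))"
    by (simp add: inf_mat_mult_lower binom_matrix_def binom_entry_def Suc.IH)
  also have "\<dots> = (\<Sum>j\<le>k. fps_nth (fps_iterate N) (Suc j) *
      fps_nth ((fps_X + fps_X ^ 2) ^ Suc j) (Suc k))"
    by (simp add: binom_matrix_def binom_entry_eq_fps_nth mult.commute del: power_Suc)
  also have "\<dots> = fps_nth (fps_iterate N oo (fps_X + fps_X ^ 2)) (Suc k)"
    by (simp add: fps_compose_nth atLeast0AtMost sum.atMost_Suc_shift
        del: power_Suc sum.atMost_Suc)
  finally show ?case
    by (simp only: fps_iterate_commute)
qed

text \<open>
  By the shift of exponents, \<open>P\<^bsub>i-1\<^esub> P\<^bsub>k-i\<^esub>\<close> pairs the coefficients of \<open>h\<^sup>i\<close> and \<open>h\<^bsup>k+1-i\<^esup>\<close>, so the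
  sum in the recursion is the coefficient of \<open>h\<^bsup>k+1\<^esup>\<close> in the square of the generating series; the
  two missing outer terms contain the constant coefficient, which is zero.
\<close>

lemma poly_singleton_poly_of_nat:
  "poly (singleton_poly k) (of_nat N :: 'a::field_char_0) = fps_nth (fps_iterate N) (Suc k)"
proof (induction N arbitrary: k)
  case 0
  show ?case
    using is_singleton_poly_seq_singleton_poly[where 'a = 'a]
    by (cases k) (auto simp: is_singleton_poly_seq_def)
next
  case (Suc N)
  let ?P = "singleton_poly :: nat \<Rightarrow> 'a poly" and ?f = "fps_iterate N :: 'a fps"
  have step: "pcompose (?P k) [:1, 1:] = ?P k + (\<Sum>i=1..k. ?P (i - 1) * ?P (k - i))"
    using is_singleton_poly_seq_singleton_poly[where 'a = 'a]
    by (cases k) (auto simp: is_singleton_poly_seq_def pcompose_1)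
  have "poly (?P k) (of_nat (Suc N)) = poly (pcompose (?P k) [:1, 1:]) (of_nat N)"
    by (simp add: poly_pcompose)
  also have "\<dots> = fps_nth ?f (Suc k) + (\<Sum>i=1..k. fps_nth ?f i * fps_nth ?f (Suc k - i))"
    unfolding step by (auto simp: poly_sum Suc.IH Suc_diff_le intro!: sum.cong)
  also have "(\<Sum>i=1..k. fps_nth ?f i * fps_nth ?f (Suc k - i)) =
      (\<Sum>i=0..Suc k. fps_nth ?f i * fps_nth ?f (Suc k - i))"
    by (intro sum.mono_neutral_left) (auto simp: not_le le_Suc_eq Suc_le_eq)
  also have "\<dots> = fps_nth (?f ^ 2) (Suc k)"
    by (simp add: power2_eq_square fps_mult_nth)
  finally show ?case
    by simp
qed


section \<open>The polynomials as a column of the matrix exponential\<close>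

lemma poly_eqI_of_nat:
  fixes p q :: "'a::field_char_0 poly"
  assumes "\<And>N. poly p (of_nat N) = poly q (of_nat N)"
  shows "p = q"
proof -
  have "infinite (range (of_nat :: nat \<Rightarrow> 'a))"
    by (simp add: finite_image_iff inj_of_nat)
  moreover have "range of_nat \<subseteq> {x. poly (p - q) x = 0}"
    using assms by auto
  ultimately have "p - q = 0"
    using poly_roots_finite finite_subset by blast
  then show ?thesis
    by simp
qed

theorem proposition3p11:
  shows "(singleton_poly :: nat \<Rightarrow> 'a::field_char_0 poly) =
    inf_mat_vec (inf_mat_exp_X (inf_mat_ln binom_matrix)) first_unit_vec"
proof
  fix k
  let ?E = "inf_mat_exp_X (inf_mat_ln binom_matrix) :: 'a poly inf_matrix"
  have lower: "strictly_lower (inf_mat_diff binom_matrix inf_mat_one :: 'a inf_matrix)"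
    by (simp add: strictly_lower_def binom_matrix_minus_one_strict_lower)
  have "inf_mat_vec ?E first_unit_vec k = (\<Sum>l\<in>{0}. ?E k l * first_unit_vec l)"
    unfolding inf_mat_vec_def
    by (rule Sum_any.expand_superset) (auto simp: first_unit_vec_def)
  then have "inf_mat_vec ?E first_unit_vec k = ?E k 0"
    by (simp add: first_unit_vec_def)
  moreover have "singleton_poly k = ?E k 0"
    by (rule poly_eqI_of_nat)
       (simp add: poly_singleton_poly_of_nat poly_inf_mat_exp_X_ln[OF lower]
        binom_matrix_power_first_column)
  ultimately show "singleton_poly k = inf_mat_vec ?E first_unit_vec k"
    by simp
qed

end
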